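(* Let $S_2:\mathbb{R}^n\rightrightarrows\mathbb{R}^m$ be a set-valued map with closed graph, let $S_1:\mathbb{R}^n\to(\mathbb{R}^m)^l$ be single-valued and differentiable ($S_1(x)$ is a matrix with $m$ rows and $l$ columns), and let $S:\mathbb{R}^n\rightrightarrows\mathbb{R}^l$ be the product \[S(x)=\bigcup_{y\in S_2(x)}S_1(x)^Ty.\] Let $(\bar x,\bar z)\in\mathrm{gph}\,S$, let $(u,w)\in\mathbb{R}^n\times\mathbb{R}^l$ be a pair of directions, and define $\widetilde\Xi:\mathbb{R}^n\times\mathbb{R}^l\rightrightarrows\mathbb{R}^m$ by \[\widetilde\Xi(x,z):=\{y\in S_2(x): S_1(x)^Ty=z\}.\] Suppose that $\widetilde\Xi$ is inner semicompact at $(\bar x,\bar z)$ with respect to $\mathrm{dom}\,\widetilde\Xi$. (a) If $\widetilde\Xi$ is inner calm* at $(\bar x,\bar z)$ with respect to $\mathrm{dom}\,\widetilde\Xi$ in the fuzzy sense, then \[DS(\bar x,\bar z)(u)=\bigcup_{\bar y\in\widetilde\Xi(\bar x,\bar z)}\nabla\langle\bar y,S_1\rangle(\bar x)u+S_1(\bar x)^TDS_2(\bar x,\bar y)(u).\] (b) If $\widetilde\Xi$ is inner calm* at $(\bar x,\bar z)$ in direction $(u,w)$ with respect to $\mathrm{dom}\,\widetilde\Xi$, then for all $z^*\in\mathbb{R}^l$ \[D^*S((\bar x,\bar z);(u,w))(z^* )\subset\bigcup_{\bar y\in\widetilde\Xi(\bar x,\bar z)}\ \bigcup_{v\in D\widetilde\Xi((\bar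 x,\bar z),\bar y)(u,w)}\nabla\langle\bar y,S_1\rangle(\bar x)^Tz^*+D^*S_2((\bar x,\bar y);(u,v))(S_1(\bar x)z^* ).\] (c) Under just the inner semicompactness of $\widetilde\Xi$ at $(\bar x,\bar z)$ with respect to $\mathrm{dom}\,\widetilde\Xi$, for all $z^*\in\mathbb{R}^l$ \[D^*S(\bar x,\bar z)(z^* )\subset\bigcup_{\bar y\in\widetilde\Xi(\bar x,\bar z)}\nabla\langle\bar y,S_1\rangle(\bar x)^Tz^*+D^*S_2(\bar x,\bar y)(S_1(\bar x)z^* ).\]
   Context: For $y\in\mathbb{R}^m$, $\langle y,S_1\rangle:\mathbb{R}^n\to\mathbb{R}^l$ is $\langle y,S_1\rangle(x)=S_1(x)^Ty$, and $\nabla\langle y,S_1\rangle(x)$ is its $l\times n$ Jacobian. For a set $\Omega$ and $\bar z\in\Omega$: $T_\Omega(\bar z)=\{w:\exists t_k\downarrow0,\,w_k\to w,\ \bar z+t_kw_k\in\Omega\ \forall k\}$; $\widehat N_\Omega(\bar z)=T_\Omega(\bar z)^\circ$ (negative polar); limiting normal cone $N_\Omega(\bar z)=\{z^*:\exists z_k\to\bar z,\ z_k^*\to z^*,\ z_k^*\in\widehat N_\Omega(z_k)\ \forall k\}$; directional limiting normal cone $N_\Omega(\bar z;w)=\{z^*:\exists t_k\downarrow0,\ w_k\to w,\ z_k^*\to z^*,\ z_k^*\in\widehat N_\Omega(\bar z+t_kw_k)\ \forall k\}$. All are empty at points outside $\Omega$. For a set-valued $M$ and $(\bar x,\bar y)\in\mathrm{gph}\,M$: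 graphical derivative $DM(\bar x,\bar y)(u)=\{v:(u,v)\in T_{\mathrm{gph}\,M}(\bar x,\bar y)\}$; limiting coderivative $D^*M(\bar x,\bar y)(v^* )=\{u^*:(u^*,-v^* )\in N_{\mathrm{gph}\,M}(\bar x,\bar y)\}$; directional limiting coderivative $D^*M((\bar x,\bar y);(u,v))(v^* )=\{u^*:(u^*,-v^* )\in N_{\mathrm{gph}\,M}((\bar x,\bar y);(u,v))\}$. For a set-valued map $R:\mathbb{R}^p\rightrightarrows\mathbb{R}^q$, $\mathrm{dom}\,R=\{y:R(y)\ne\emptyset\}$ and $\Omega\subset\mathbb{R}^p$: - a sequence $y_k$ converges to $\bar y$ from direction $v$ if $y_k=\bar y+t_kv_k$ for some $t_k\downarrow0$, $v_k\to v$; - $R$ is inner semicompact at $\bar y$ with respect to $\Omega$ if for every sequence $y_k\to\bar y$ with $y_k\in\Omega$ there exist an infinite $K\subset\mathbb{N}$ and $x_k\in R(y_k)$ ($k\in K$) converging to some $\bar x$; - $R$ is inner calm* at $\bar y$ in direction $v$ with respect to $\Omega$ if there is $\kappa>0$ such that for every sequence $y_k\in\Omega$ converging to $\bar y$ from $v$ there exist an infinite $K\subset\mathbb{N}$, $x_k\in R(y_k)$ ($k\in K$) and $\bar x$ with $\|x_k-\bar x\|\le\kappa\|y_k-\bar y\|$ for $k\in K$; - $R$ is inner calm* at $\bar y$ with respect to $\Omega$ in the fuzzy sense if for every unit direction $v$, either $v\notin T_\Omega(\bar y)$, or there exist $\kappa_v>0$, a sequence $y_k\in\Omega$ converging to $\bar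 y$ from $v$, $x_k\in R(y_k)$ and a point $\bar x$ with $\|x_k-\bar x\|\le\kappa_v\|y_k-\bar y\|$ for all $k$.
   Formalization: In (b) and (c) the derivative of S_1 is additionally assumed continuous at x̄; with mere differentiability they fail, e.g. S_2≡{1}, S_1(x)=x² sin(1/x), S_1(0)=0, at (0,0) with (u,w)=(1,0), z*=1. *)

theory Defs
  imports "HOL-Analysis.Analysis"
begin

section \<open>Tangent and normal cones\<close>

text \<open>Throughout, ``t down to 0'' means a sequence of positive reals with limit 0; monotonicity is
  not required (every such sequence has a decreasing subsequence). All cones are empty at points
  outside the set.\<close>

definition tangent_cone :: "'a::real_normed_vector set \<Rightarrow> 'a \<Rightarrow> 'a set" where
  "tangent_cone \<Omega> z =
    {w. z \<in> \<Omega> \<and> (\<exists>t ws. (\<forall>k::nat. (0::real) < t k) \<and> t \<longlonglongrightarrow> 0 \<and> ws \<longlonglongrightarrow> w \<and>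
          (\<forall>k. z + t k *\<^sub>R ws k \<in> \<Omega>))}"

definition negative_polar :: "'a::real_inner set \<Rightarrow> 'a set" where
  "negative_polar C = {zs. \<forall>w\<in>C. zs \<bullet> w \<le> 0}"

text \<open>The guard is needed here: the polar of the empty cone would be the whole space.\<close>

definition regular_normal_cone :: "'a::real_inner set \<Rightarrow> 'a \<Rightarrow> 'a set" where
  "regular_normal_cone \<Omega> z = (if z \<in> \<Omega> then negative_polar (tangent_cone \<Omega> z) else {})"

definition limiting_normal_cone :: "'a::real_inner set \<Rightarrow> 'a \<Rightarrow> 'a set" where
  "limiting_normal_cone \<Omega> z =
    {zs. z \<in> \<Omega> \<and> (\<exists>(z_seq :: nat \<Rightarrow> 'a) zs_seq. z_seq \<longlonglongrightarrow> z \<and> zs_seq \<longlonglongrightarrow> zs \<and>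
          (\<forall>k. zs_seq k \<in> regular_normal_cone \<Omega> (z_seq k)))}"

definition directional_normal_cone :: "'a::real_inner set \<Rightarrow> 'a \<Rightarrow> 'a \<Rightarrow> 'a set" where
  "directional_normal_cone \<Omega> z w =
    {zs. z \<in> \<Omega> \<and> (\<exists>t ws zs_seq. (\<forall>k::nat. (0::real) < t k) \<and> t \<longlonglongrightarrow> 0 \<and> ws \<longlonglongrightarrow> w \<and>
          zs_seq \<longlonglongrightarrow> zs \<and> (\<forall>k. zs_seq k \<in> regular_normal_cone \<Omega> (z + t k *\<^sub>R ws k)))}"

section \<open>Generalized derivatives of set-valued maps\<close>

definition gph :: "('a \<Rightarrow> 'b set) \<Rightarrow> ('a \<times> 'b) set" where
  "gph M = {(x, y). y \<in> M x}"

definition dom_map :: "('a \<Rightarrow> 'b set) \<Rightarrow> 'a set" where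
  "dom_map M = {x. M x \<noteq> {}}"

definition graphical_derivative ::
  "('a::real_normed_vector \<Rightarrow> 'b::real_normed_vector set) \<Rightarrow> 'a \<times> 'b \<Rightarrow> 'a \<Rightarrow> 'b set" where
  "graphical_derivative M p u = {v. (u, v) \<in> tangent_cone (gph M) p}"

definition coderivative ::
  "('a::real_inner \<Rightarrow> 'b::real_inner set) \<Rightarrow> 'a \<times> 'b \<Rightarrow> 'b \<Rightarrow> 'a set" where
  "coderivative M p vs = {us. (us, - vs) \<in> limiting_normal_cone (gph M) p}"

definition directional_coderivative ::
  "('a::real_inner \<Rightarrow> 'b::real_inner set) \<Rightarrow> 'a \<times> 'b \<Rightarrow> 'a \<times> 'b \<Rightarrow> 'b \<Rightarrow> 'a set" where
  "directional_coderivative M p d vs = {us. (us, - vs) \<in> directional_normal_cone (gph M) p d}"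

section \<open>Inner semicompactness and inner calmness*\<close>

definition converges_from_direction ::
  "(nat \<Rightarrow> 'a::real_normed_vector) \<Rightarrow> 'a \<Rightarrow> 'a \<Rightarrow> bool" where
  "converges_from_direction y_seq y v \<longleftrightarrow>
    (\<exists>t vs. (\<forall>k. (0::real) < t k) \<and> t \<longlonglongrightarrow> 0 \<and> vs \<longlonglongrightarrow> v \<and> (\<forall>k. y_seq k = y + t k *\<^sub>R vs k))"

text \<open>The infinite index set is the range of the strictly increasing map \<open>r\<close>, and \<open>x_seq k\<close> is the
  element associated with the index \<open>r k\<close>.\<close>

definition inner_semicompact ::
  "('a::real_normed_vector \<Rightarrow> 'b::real_normed_vector set) \<Rightarrow> 'a \<Rightarrow> 'a set \<Rightarrow> bool" where
  "inner_semicompact R y \<Omega> \<longleftrightarrow>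
    (\<forall>y_seq. y_seq \<longlonglongrightarrow> y \<and> (\<forall>k. y_seq k \<in> \<Omega>) \<longrightarrow>
      (\<exists>(r :: nat \<Rightarrow> nat) x_seq x. strict_mono r \<and> (\<forall>k. x_seq k \<in> R (y_seq (r k))) \<and>
        x_seq \<longlonglongrightarrow> x))"

definition inner_calm_star_dir ::
  "('a::real_normed_vector \<Rightarrow> 'b::real_normed_vector set) \<Rightarrow> 'a \<Rightarrow> 'a \<Rightarrow> 'a set \<Rightarrow> bool" where
  "inner_calm_star_dir R y v \<Omega> \<longleftrightarrow>
    (\<exists>\<kappa>>0. \<forall>y_seq. (\<forall>k. y_seq k \<in> \<Omega>) \<and> converges_from_direction y_seq y v \<longrightarrow>
      (\<exists>K x_seq x. infinite K \<and>
        (\<forall>k\<in>K. x_seq k \<in> R (y_seq k) \<and> norm (x_seq k - x) \<le> \<kappa> * norm (y_seq k - y))))"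

definition inner_calm_star_fuzzy ::
  "('a::real_normed_vector \<Rightarrow> 'b::real_normed_vector set) \<Rightarrow> 'a \<Rightarrow> 'a set \<Rightarrow> bool" where
  "inner_calm_star_fuzzy R y \<Omega> \<longleftrightarrow>
    (\<forall>v. norm v = 1 \<longrightarrow> v \<notin> tangent_cone \<Omega> y \<or>
      (\<exists>\<kappa>>0. \<exists>y_seq x_seq x. (\<forall>k. y_seq k \<in> \<Omega>) \<and> converges_from_direction y_seq y v \<and>
        (\<forall>k. x_seq k \<in> R (y_seq k) \<and> norm (x_seq k - x) \<le> \<kappa> * norm (y_seq k - y))))"

section \<open>The product of a single-valued and a set-valued map\<close>

text \<open>A matrix with m rows and l columns has type \<open>real^'l^'m\<close>.\<close>

definition product_map ::
  "(real^'n \<Rightarrow> real^'l^'m) \<Rightarrow> (real^'n \<Rightarrow> (real^'m) set) \<Rightarrow> real^'n \<Rightarrow> (real^'l) set" where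
  "product_map S1 S2 x = (\<Union>y\<in>S2 x. {transpose (S1 x) *v y})"

definition Xi_tilde ::
  "(real^'n \<Rightarrow> real^'l^'m) \<Rightarrow> (real^'n \<Rightarrow> (real^'m) set) \<Rightarrow> (real^'n) \<times> (real^'l) \<Rightarrow> (real^'m) set"
  where "Xi_tilde S1 S2 = (\<lambda>(x, z). {y \<in> S2 x. transpose (S1 x) *v y = z})"

definition scalarization :: "real^'m \<Rightarrow> (real^'n \<Rightarrow> real^'l^'m) \<Rightarrow> real^'n \<Rightarrow> real^'l" where
  "scalarization y S1 = (\<lambda>x. transpose (S1 x) *v y)"

definition nabla :: "real^'m \<Rightarrow> (real^'n \<Rightarrow> real^'l^'m) \<Rightarrow> real^'n \<Rightarrow> real^'n^'l" where
  "nabla y S1 x = jacobian (scalarization y S1) (at x)"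

text \<open>Mere differentiability of \<open>S1\<close> does not suffice for the coderivative inclusions
  (take the constant map \<open>S2\<close> with value 1 and \<open>S1 x = x\<^sup>2 * sin (1 / x)\<close> at 0), so these assume that
  the derivative is continuous at the reference point. In finite dimensions, pointwise continuity in the
  direction \<open>h\<close> is the same as continuity with respect to the operator norm.\<close>

definition derivative_continuous_at ::
  "('a::euclidean_space \<Rightarrow> 'b::euclidean_space) \<Rightarrow> 'a \<Rightarrow> bool" where
  "derivative_continuous_at f x \<longleftrightarrow> (\<forall>h. isCont (\<lambda>x'. frechet_derivative f (at x') h) x)"

end

theory Submission
  imports Defs
begin

text \<open>
  The map \<open>F (x, y) = (x, S1(x)\<^sup>T y)\<close> sends the graph of \<open>S2\<close> onto the graph of the product, and
  \<open>Xi_tilde\<close> lists the preimages of a point. The three rules are therefore image rules for tangent and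
  normal cones. They hold in one direction for every differentiable map: \<open>F'\<close> carries tangents of the
  source to tangents of the image (\<open>tangent_cone_image\<close>), and, by polarity, the adjoint of \<open>F'\<close> carries
  regular normals of the image to regular normals of the source (\<open>regular_normal_cone_pullback\<close>).
  At \<open>(x, y)\<close> the derivative sends \<open>(h, v)\<close> to \<open>(h, \<nabla>\<langle>y, S1\<rangle>(x) h + S1(x)\<^sup>T v)\<close>; its adjoint sends
  \<open>(a, b)\<close> to \<open>(a + \<nabla>\<langle>y, S1\<rangle>(x)\<^sup>T b, S1(x) b)\<close>. These are the expressions in the rules.

  What remains is to lift sequences from the image to the source, and this is the task of the hypotheses
  on \<open>Xi_tilde\<close>. Inner semicompactness lifts a convergent sequence, along a subsequence, to a convergent
  one. Calmness lifts a sequence that converges from a direction to one that again converges from a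
  direction: the difference quotients of the lifted sequence are bounded, so by compactness a
  subsequence of them has a limit \<open>v\<close> (\<open>calm_selection_subsequence\<close>). Since the graph of \<open>S2\<close> is closed
  and \<open>S1\<close> is continuous, the limit of the lifted points lies in \<open>Xi_tilde S1 S2 (xbar, zbar)\<close>.

  For tangents one lifted sequence per direction is enough, hence the fuzzy form of calmness, and the
  rule becomes an equality. For limiting normals the regular normals are pulled back at the lifted
  points and one passes to the limit; there the Jacobians at nearby points have to converge, which is
  what continuity of the derivative of \<open>S1\<close> at \<open>xbar\<close> provides.
\<close>

section \<open>Cones under differentiable maps\<close>

lemma tangent_coneI:
  assumes "p \<in> \<Omega>" "\<forall>k::nat. (0::real) < t k" "t \<longlonglongrightarrow> 0" "ws \<longlonglongrightarrow> w"
    "\<And>k. p + t k *\<^sub>R ws k \<in> \<Omega>"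
  shows "w \<in> tangent_cone \<Omega> p"
  unfolding tangent_cone_def mem_Collect_eq using assms by (intro conjI exI[of _ t] exI[of _ ws]) auto

text \<open>Differentiability controls the quotients even if the direction varies with the step, because
  the remainder is small relative to \<open>t k * norm (ws k)\<close> and convergent directions are bounded.\<close>

lemma difference_quotient_tendsto:
  fixes F :: "'a::real_normed_vector \<Rightarrow> 'b::real_normed_vector"
  assumes F: "(F has_derivative F') (at p)"
    and t: "\<forall>k. (0::real) < t k" "t \<longlonglongrightarrow> 0" and ws: "ws \<longlonglongrightarrow> w"
  shows "(\<lambda>k. (F (p + t k *\<^sub>R ws k) - F p) /\<^sub>R t k) \<longlonglongrightarrow> F' w"
proof -
  have lin: "bounded_linear F'" using F by (rule has_derivative_bounded_linear)
  obtain C where C: "\<And>k. norm (ws k) \<le> C" and Cpos: "C > 0"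
    using convergent_imp_Bseq[OF convergentI[OF ws]] by (auto simp: Bseq_def)
  have F'lim: "(\<lambda>k. F' (ws k)) \<longlonglongrightarrow> F' w"
    using bounded_linear.tendsto[OF lin ws] .
  have h0: "(\<lambda>k. t k *\<^sub>R ws k) \<longlonglongrightarrow> 0"
    using tendsto_scaleR[OF t(2) ws] by simp
  have "(\<lambda>k. (F (p + t k *\<^sub>R ws k) - F p) /\<^sub>R t k - F' (ws k)) \<longlonglongrightarrow> 0"
  proof (rule LIMSEQ_I)
    fix e :: real assume e: "e > 0"
    have "e / (2 * C) > 0" using e Cpos by simp
    then obtain d where d: "d > 0"
      and *: "\<And>y. norm (y - p) < d \<Longrightarrow> norm (F y - F p - F' (y - p)) \<le> e / (2*C) * norm (y - p)"
      using F unfolding has_derivative_at_alt by blast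
    obtain N where N: "\<And>k. k \<ge> N \<Longrightarrow> norm (t k *\<^sub>R ws k) < d"
      using LIMSEQ_D[OF h0 d] by auto
    show "\<exists>N. \<forall>k\<ge>N. norm ((F (p + t k *\<^sub>R ws k) - F p) /\<^sub>R t k - F' (ws k) - 0) < e"
    proof (intro exI allI impI)
      fix k assume k: "k \<ge> N"
      have tk: "t k > 0" using t by simp
      have "F' (t k *\<^sub>R ws k) = t k *\<^sub>R F' (ws k)"
        using lin by (rule bounded_linear.linear[THEN linear_scale])
      then have "(F (p + t k *\<^sub>R ws k) - F p) /\<^sub>R t k - F' (ws k) =
          (F (p + t k *\<^sub>R ws k) - F p - F' (t k *\<^sub>R ws k)) /\<^sub>R t k"
        using tk by (simp add: algebra_simps)
      also have "norm \<dots> = norm (F (p + t k *\<^sub>R ws k) - F p - F' (t k *\<^sub>R ws k)) / t k"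
        using tk by (simp add: divide_inverse_commute)
      also have "\<dots> \<le> (e / (2*C) * norm (t k *\<^sub>R ws k)) / t k"
        using *[of "p + t k *\<^sub>R ws k"] N[OF k] tk by (intro divide_right_mono) auto
      also have "\<dots> = e / (2*C) * norm (ws k)" using tk by simp
      also have "\<dots> \<le> e / (2*C) * C" using e Cpos C by (intro mult_left_mono) auto
      also have "\<dots> < e" using e Cpos by simp
      finally show "norm ((F (p + t k *\<^sub>R ws k) - F p) /\<^sub>R t k - F' (ws k) - 0) < e" by simp
    qed
  qed
  from tendsto_add[OF this F'lim] show ?thesis by simp
qed

lemma tangent_cone_image:
  assumes F: "(F has_derivative F') (at p)" and w: "w \<in> tangent_cone \<Omega> p"
  shows "F' w \<in> tangent_cone (F ` \<Omega>) (F p)"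
proof -
  obtain t ws where p: "p \<in> \<Omega>" and t: "\<forall>k. (0::real) < t k" "t \<longlonglongrightarrow> 0"
    and ws: "ws \<longlonglongrightarrow> w" and in\<Omega>: "\<And>k. p + t k *\<^sub>R ws k \<in> \<Omega>"
    using w unfolding tangent_cone_def by blast
  have "F p + t k *\<^sub>R ((F (p + t k *\<^sub>R ws k) - F p) /\<^sub>R t k) \<in> F ` \<Omega>" for k
    using in\<Omega>[of k] t(1)[rule_format, of k] by simp
  with p show ?thesis by (intro tangent_coneI[OF _ t difference_quotient_tendsto[OF F t ws]]) auto
qed

text \<open>The polar form of the preceding inclusion: the adjoint of the derivative pulls regular normals
  of the image back to regular normals of the source. The adjoint enters only through the pairing.\<close>

lemma regular_normal_cone_pullback:
  assumes F: "(F has_derivative F') (at p)" and p: "p \<in> \<Omega>"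
    and zs: "zs \<in> regular_normal_cone (F ` \<Omega>) (F p)"
    and adj: "\<And>h. ps \<bullet> h = zs \<bullet> F' h"
  shows "ps \<in> regular_normal_cone \<Omega> p"
proof -
  have "F p \<in> F ` \<Omega>" using p by simp
  then have polar: "zs \<bullet> v \<le> 0" if "v \<in> tangent_cone (F ` \<Omega>) (F p)" for v
    using zs that by (simp add: regular_normal_cone_def negative_polar_def)
  show ?thesis
    using p polar[OF tangent_cone_image[OF F]]
    by (simp add: regular_normal_cone_def negative_polar_def adj)
qed

lemma tangent_cone_scaleR:
  assumes w: "w \<in> tangent_cone \<Omega> p" and c: "(0::real) < c"
  shows "c *\<^sub>R w \<in> tangent_cone \<Omega> p"
proof -
  obtain t ws where p: "p \<in> \<Omega>" and t: "\<forall>k. (0::real) < t k" "t \<longlonglongrightarrow> 0"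
    and ws: "ws \<longlonglongrightarrow> w" and in\<Omega>: "\<And>k. p + t k *\<^sub>R ws k \<in> \<Omega>"
    using w unfolding tangent_cone_def by blast
  have "(\<lambda>k. t k / c) \<longlonglongrightarrow> 0" using tendsto_divide[OF t(2) tendsto_const[of c]] c by simp
  moreover have "(\<lambda>k. c *\<^sub>R ws k) \<longlonglongrightarrow> c *\<^sub>R w" by (intro tendsto_intros ws)
  moreover have "p + (t k / c) *\<^sub>R (c *\<^sub>R ws k) \<in> \<Omega>" for k using in\<Omega>[of k] c by simp
  moreover have "\<forall>k. 0 < t k / c" using t c by simp
  ultimately show ?thesis using p by (intro tangent_coneI[of p \<Omega> "\<lambda>k. t k / c"])
qed

lemma zero_in_tangent_cone: "p \<in> \<Omega> \<Longrightarrow> 0 \<in> tangent_cone \<Omega> p"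
  by (rule tangent_coneI[OF _ _ LIMSEQ_Suc[OF lim_1_over_n] tendsto_const]) simp_all

section \<open>Calm selections and graphical derivatives\<close>

text \<open>A calm selection along points that converge from a direction has bounded difference quotients
  towards its limit; by compactness a subsequence of them converges, so that the selection itself
  converges from a direction.\<close>

lemma calm_selection_subsequence:
  fixes R :: "'a::real_normed_vector \<Rightarrow> 'b::euclidean_space set"
  assumes R: "closed (gph R)"
    and t: "\<forall>k. (0::real) < t k" "t \<longlonglongrightarrow> 0" and ds: "ds \<longlonglongrightarrow> d"
    and y: "\<And>k. y k \<in> R (p + t k *\<^sub>R ds k)"
    and calm: "\<And>k. norm (y k - q) \<le> \<kappa> * norm (t k *\<^sub>R ds k)" and \<kappa>: "\<kappa> > 0"
  shows "q \<in> R p"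
    and "\<exists>r vs v. strict_mono (r :: nat \<Rightarrow> nat) \<and> vs \<longlonglongrightarrow> v \<and>
      (\<forall>k. y (r k) = q + t (r k) *\<^sub>R vs k) \<and> v \<in> graphical_derivative R (p, q) d"
proof -
  obtain C where C: "\<And>k. norm (ds k) \<le> C"
    using convergent_imp_Bseq[OF convergentI[OF ds]] by (auto simp: Bseq_def)
  have "norm ((y k - q) /\<^sub>R t k) \<le> \<kappa> * C" for k
  proof -
    have tk: "t k > 0" using t by simp
    have "norm ((y k - q) /\<^sub>R t k) = norm (y k - q) / t k"
      using tk by (simp add: divide_inverse_commute)
    also have "\<dots> \<le> \<kappa> * norm (t k *\<^sub>R ds k) / t k"
      using calm[of k] tk by (intro divide_right_mono) auto
    also have "\<dots> = \<kappa> * norm (ds k)" using tk by simp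
    also have "\<dots> \<le> \<kappa> * C" using \<kappa> C by (intro mult_left_mono) auto
    finally show ?thesis .
  qed
  then have "bounded (range (\<lambda>k. (y k - q) /\<^sub>R t k))"
    by (auto simp: bounded_iff)
  then obtain v r where r: "strict_mono r"
    and v: "((\<lambda>k. (y k - q) /\<^sub>R t k) \<circ> r) \<longlonglongrightarrow> v"
    using bounded_imp_convergent_subsequence by blast
  define vs where "vs k = (y (r k) - q) /\<^sub>R t (r k)" for k
  have vs: "vs \<longlonglongrightarrow> v" using v by (simp add: vs_def[abs_def] o_def)
  have yr: "y (r k) = q + t (r k) *\<^sub>R vs k" for k
    using t(1)[rule_format, of "r k"] by (simp add: vs_def)
  have tr: "(\<lambda>k. t (r k)) \<longlonglongrightarrow> 0" and dr: "(\<lambda>k. ds (r k)) \<longlonglongrightarrow> d"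
    using LIMSEQ_subseq_LIMSEQ[OF t(2) r] LIMSEQ_subseq_LIMSEQ[OF ds r] by (simp_all add: o_def)
  have dv: "(\<lambda>k. (ds (r k), vs k)) \<longlonglongrightarrow> (d, v)" by (intro tendsto_Pair dr vs)
  have mem: "(p, q) + t (r k) *\<^sub>R (ds (r k), vs k) \<in> gph R" for k
    using y[of "r k"] yr[of k] by (simp add: gph_def)
  have "(\<lambda>k. (p, q) + t (r k) *\<^sub>R (ds (r k), vs k)) \<longlonglongrightarrow> (p, q) + 0 *\<^sub>R (d, v)"
    by (intro tendsto_intros tr dv)
  then have pq: "(p, q) \<in> gph R"
    using closed_sequentially[OF R, of "\<lambda>k. (p, q) + t (r k) *\<^sub>R (ds (r k), vs k)"] mem by simp
  then show "q \<in> R p" by (simp add: gph_def)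
  have "v \<in> graphical_derivative R (p, q) d"
    unfolding graphical_derivative_def mem_Collect_eq
    using pq t(1) by (intro tangent_coneI[OF _ _ tr dv mem]) auto
  then have "strict_mono r \<and> vs \<longlonglongrightarrow> v \<and> (\<forall>k. y (r k) = q + t (r k) *\<^sub>R vs k) \<and>
      v \<in> graphical_derivative R (p, q) d"
    using r vs yr by simp
  then show "\<exists>r vs v. strict_mono (r :: nat \<Rightarrow> nat) \<and> vs \<longlonglongrightarrow> v \<and>
      (\<forall>k. y (r k) = q + t (r k) *\<^sub>R vs k) \<and> v \<in> graphical_derivative R (p, q) d"
    by (intro exI)
qed

text \<open>Fuzzy inner calmness* lifts every tangent direction of the domain to a tangent direction of the
  graph. Unit directions are covered by the calm selections; the others follow since tangent cones are
  cones, except for the zero direction, which always lifts to zero.\<close>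

lemma fuzzy_calm_lifts_tangents:
  fixes R :: "'a::real_normed_vector \<Rightarrow> 'b::euclidean_space set"
  assumes R: "closed (gph R)" and fuzzy: "inner_calm_star_fuzzy R p (dom_map R)"
    and d: "d \<in> tangent_cone (dom_map R) p"
  obtains q v where "q \<in> R p" "v \<in> graphical_derivative R (p, q) d"
proof (cases "d = 0")
  case True
  have "p \<in> dom_map R" using d by (simp add: tangent_cone_def)
  then obtain q where q: "q \<in> R p" by (auto simp: dom_map_def)
  then have "0 \<in> tangent_cone (gph R) (p, q)" by (intro zero_in_tangent_cone) (simp add: gph_def)
  then have "0 \<in> graphical_derivative R (p, q) d"
    by (simp add: graphical_derivative_def True zero_prod_def)
  with q that show ?thesis by blast
next
  case False
  define e where "e = d /\<^sub>R norm d"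
  have "e \<in> tangent_cone (dom_map R) p" "norm e = 1"
    using tangent_cone_scaleR[OF d, of "inverse (norm d)"] False by (simp_all add: e_def)
  then obtain \<kappa> y_seq y q where \<kappa>: "\<kappa> > 0" and dir: "converges_from_direction y_seq p e"
    and y: "\<forall>k. y k \<in> R (y_seq k) \<and> norm (y k - q) \<le> \<kappa> * norm (y_seq k - p)"
    using fuzzy unfolding inner_calm_star_fuzzy_def by blast
  obtain t ds where t: "\<forall>k. (0::real) < t k" "t \<longlonglongrightarrow> 0" and ds: "ds \<longlonglongrightarrow> e"
    and ys: "\<And>k. y_seq k = p + t k *\<^sub>R ds k"
    using dir unfolding converges_from_direction_def by blast
  have y': "\<And>k. y k \<in> R (p + t k *\<^sub>R ds k)" "\<And>k. norm (y k - q) \<le> \<kappa> * norm (t k *\<^sub>R ds k)"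
    using y unfolding ys by simp_all
  note calm_selection = calm_selection_subsequence[OF R t ds y' \<kappa>]
  have q: "q \<in> R p" by (rule calm_selection(1))
  obtain v where v: "v \<in> graphical_derivative R (p, q) e" using calm_selection(2) by blast
  have "norm d *\<^sub>R (e, v) \<in> tangent_cone (gph R) (p, q)"
    using v False by (intro tangent_cone_scaleR) (auto simp: graphical_derivative_def)
  then have "norm d *\<^sub>R v \<in> graphical_derivative R (p, q) d"
    using False by (simp add: graphical_derivative_def e_def)
  with q that show ?thesis by blast
qed

section \<open>The product as a differentiable image\<close>

text \<open>Bilinearity supplies continuity, limits and the product rule for the transposed product at once.\<close>

lemma bounded_bilinear_transpose_matrix_vector_mult:
  "bounded_bilinear (\<lambda>(A :: real^'l^'m) y. transpose A *v y)"
proof -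
  have comp: "(transpose A *v y) $ i = (\<Sum>j\<in>UNIV. A $ j $ i * y $ j)"
    for A :: "real^'l^'m" and y i
    by (simp add: matrix_vector_mult_def transpose_def)
  have "linear (\<lambda>A :: real^'l^'m. transpose A *v y)" for y
    by (intro linearI; simp only: vec_eq_iff comp vector_add_component vector_scaleR_component
        real_scaleR_def sum_distrib_left distrib_right sum.distrib mult.assoc; simp)
  then have "bilinear (\<lambda>(A :: real^'l^'m) y. transpose A *v y)"
    unfolding bilinear_def using matrix_vector_mul_linear by blast
  then show ?thesis by (simp only: bilinear_conv_bounded_bilinear)
qed

text \<open>Pairing the value of the product with its base point turns the graph of the product into the
  image of the graph of \<open>S2\<close>, so that the calculus of the product becomes the calculus of a
  differentiable image. The fibre of this image over \<open>(x, z)\<close> consists of the pairs \<open>(x, y)\<close>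
  with \<open>y\<close> in \<open>Xi_tilde S1 S2 (x, z)\<close>.\<close>

definition product_pairing ::
  "(real^'n \<Rightarrow> real^'l^'m) \<Rightarrow> (real^'n) \<times> (real^'m) \<Rightarrow> (real^'n) \<times> (real^'l)" where
  "product_pairing S1 = (\<lambda>(x, y). (x, transpose (S1 x) *v y))"

lemma gph_product_map: "gph (product_map S1 S2) = product_pairing S1 ` gph S2"
  by (auto simp: gph_def product_map_def product_pairing_def)

lemma gph_product_map_eq_dom: "gph (product_map S1 S2) = dom_map (Xi_tilde S1 S2)"
  by (auto simp: gph_def product_map_def dom_map_def Xi_tilde_def)

lemma mem_Xi_tilde_iff:
  "y \<in> Xi_tilde S1 S2 (x, z) \<longleftrightarrow> (x, y) \<in> gph S2 \<and> z = transpose (S1 x) *v y"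
  by (auto simp: Xi_tilde_def gph_def)

lemma closed_gph_Xi_tilde:
  fixes S1 :: "real^'n \<Rightarrow> real^'l^'m" and S2 :: "real^'n \<Rightarrow> (real^'m) set"
  assumes "closed (gph S2)" and "\<forall>x. S1 differentiable (at x)"
  shows "closed (gph (Xi_tilde S1 S2))"
proof -
  have "continuous_on UNIV S1"
    using assms(2) by (simp add: continuous_on_eq_continuous_at differentiable_imp_continuous_within)
  then have cont: "continuous_on UNIV (\<lambda>s :: ((real^'n) \<times> (real^'l)) \<times> (real^'m). S1 (fst (fst s)))"
    by (rule continuous_on_compose2) (intro continuous_intros, simp)
  let ?P = "\<lambda>s :: ((real^'n) \<times> (real^'l)) \<times> (real^'m). (fst (fst s), snd s)"
  have "gph (Xi_tilde S1 S2) = ?P -` gph S2 \<inter>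
      {s. snd (fst s) = transpose (S1 (fst (fst s))) *v snd s}"
    by (auto simp: gph_def Xi_tilde_def)
  moreover have "closed (?P -` gph S2)"
    by (intro closed_vimage assms(1) continuous_intros)
  moreover have "closed {s :: ((real^'n) \<times> (real^'l)) \<times> (real^'m).
      snd (fst s) = transpose (S1 (fst (fst s))) *v snd s}"
    by (intro closed_Collect_eq continuous_intros cont
        bounded_bilinear.continuous_on[OF bounded_bilinear_transpose_matrix_vector_mult])
  ultimately show ?thesis by (simp only: closed_Int)
qed

lemma nabla_eq_frechet_derivative:
  assumes "S1 differentiable (at x)"
  shows "nabla y S1 x *v h = transpose (frechet_derivative S1 (at x) h) *v y"
proof -
  have "(S1 has_derivative frechet_derivative S1 (at x)) (at x)"
    using assms by (simp add: frechet_derivative_works)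
  from bounded_bilinear.FDERIV[OF bounded_bilinear_transpose_matrix_vector_mult this
      has_derivative_const[of y]]
  have D: "(scalarization y S1 has_derivative
      (\<lambda>h. transpose (frechet_derivative S1 (at x) h) *v y)) (at x)"
    by (simp add: scalarization_def)
  then have "scalarization y S1 differentiable (at x)" by (auto simp: differentiable_def)
  then have "(scalarization y S1 has_derivative (\<lambda>h. nabla y S1 x *v h)) (at x)"
    unfolding nabla_def by (simp add: jacobian_works)
  from has_derivative_unique[OF this D] show ?thesis by meson
qed

lemma has_derivative_product_pairing:
  assumes "S1 differentiable (at x)"
  shows "(product_pairing S1 has_derivative
    (\<lambda>(h, v). (h, nabla y S1 x *v h + transpose (S1 x) *v v))) (at (x, y))"
proof -
  have "(S1 has_derivative frechet_derivative S1 (at x)) (at x)"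
    using assms by (simp add: frechet_derivative_works)
  then have "((\<lambda>s. S1 (fst s)) has_derivative (\<lambda>h. frechet_derivative S1 (at x) (fst h))) (at (x, y))"
    by (intro has_derivative_compose[where f = fst and g = S1, simplified])
      (auto intro!: derivative_eq_intros)
  from bounded_bilinear.FDERIV[OF bounded_bilinear_transpose_matrix_vector_mult this
      has_derivative_snd[OF has_derivative_ident]]
  have "((\<lambda>s. transpose (S1 (fst s)) *v snd s) has_derivative
      (\<lambda>h. transpose (S1 x) *v snd h + transpose (frechet_derivative S1 (at x) (fst h)) *v y))
      (at (x, y))" by simp
  from has_derivative_Pair[OF has_derivative_fst[OF has_derivative_ident] this]
  show ?thesis
    by (simp add: product_pairing_def case_prod_unfold nabla_eq_frechet_derivative[OF assms] add.commute)
qed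

section \<open>Tangents\<close>

text \<open>Sequences in the graph of \<open>Xi_tilde\<close> carry a point of the graph of \<open>S2\<close> together with its
  image under the pairing. So a graphical derivative of \<open>Xi_tilde\<close> in direction \<open>(u, w)\<close> is one of
  \<open>S2\<close> in direction \<open>u\<close>, and \<open>w\<close> is forced to be the directional derivative of the pairing.\<close>

lemma graphical_derivative_Xi_tilde:
  assumes S1: "S1 differentiable (at x)"
    and v: "v \<in> graphical_derivative (Xi_tilde S1 S2) ((x, z), y) (u, w)"
  shows "v \<in> graphical_derivative S2 (x, y) u"
    and "w = nabla y S1 x *v u + transpose (S1 x) *v v"
proof -
  let ?G = "gph (Xi_tilde S1 S2)"
  let ?P = "\<lambda>s :: (_ \<times> _) \<times> _. (fst (fst s), snd s)"
  have T: "((u, w), v) \<in> tangent_cone ?G ((x, z), y)" using v by (simp add: graphical_derivative_def)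
  obtain t ds where mem: "((x, z), y) \<in> ?G" and t: "\<forall>k. (0::real) < t k" "t \<longlonglongrightarrow> 0"
    and ds: "ds \<longlonglongrightarrow> ((u, w), v)" and ink: "\<And>k. ((x, z), y) + t k *\<^sub>R ds k \<in> ?G"
    using T unfolding tangent_cone_def by blast
  let ?es = "\<lambda>k. (fst (fst (ds k)), snd (ds k))"
  have es: "?es \<longlonglongrightarrow> (u, v)"
    using tendsto_Pair[OF tendsto_fst[OF tendsto_fst[OF ds]] tendsto_snd[OF ds]] by simp
  have z: "(x, y) \<in> gph S2" "z = transpose (S1 x) *v y"
    using mem by (simp_all add: gph_def Xi_tilde_def)
  have step: "(x, y) + t k *\<^sub>R ?es k \<in> gph S2"
    "product_pairing S1 ((x, y) + t k *\<^sub>R ?es k) = (x, z) + t k *\<^sub>R fst (ds k)" for k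
    using ink[of k] by (cases "ds k"; cases "fst (ds k)";
      force simp: gph_def Xi_tilde_def product_pairing_def)+
  show "v \<in> graphical_derivative S2 (x, y) u"
    unfolding graphical_derivative_def mem_Collect_eq
    by (rule tangent_coneI[OF z(1) t es step(1)])
  have "(\<lambda>k. (product_pairing S1 ((x, y) + t k *\<^sub>R ?es k) - product_pairing S1 (x, y)) /\<^sub>R t k)
      \<longlonglongrightarrow> (u, nabla y S1 x *v u + transpose (S1 x) *v v)"
    using difference_quotient_tendsto[OF has_derivative_product_pairing[OF S1] t es] by simp
  moreover have "(product_pairing S1 ((x, y) + t k *\<^sub>R ?es k) - product_pairing S1 (x, y)) /\<^sub>R t k
      = fst (ds k)" for k
  proof -
    have "product_pairing S1 (x, y) = (x, z)" using z(2) by (simp add: product_pairing_def)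
    then show ?thesis using step(2)[of k] t(1)[rule_format, of k] by simp
  qed
  ultimately have "(\<lambda>k. fst (ds k)) \<longlonglongrightarrow> (u, nabla y S1 x *v u + transpose (S1 x) *v v)"
    by simp
  moreover have "(\<lambda>k. fst (ds k)) \<longlonglongrightarrow> (u, w)" using tendsto_fst[OF ds] by simp
  ultimately show "w = nabla y S1 x *v u + transpose (S1 x) *v v"
    using LIMSEQ_unique by blast
qed

lemma graphical_derivative_product_supset:
  assumes S1: "S1 differentiable (at x)" and y: "y \<in> Xi_tilde S1 S2 (x, z)"
    and v: "v \<in> graphical_derivative S2 (x, y) u"
  shows "nabla y S1 x *v u + transpose (S1 x) *v v \<in>
    graphical_derivative (product_map S1 S2) (x, z) u"
  using tangent_cone_image[OF has_derivative_product_pairing[OF S1], of "(u, v)" "gph S2" y] y v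
  by (simp add: graphical_derivative_def gph_product_map mem_Xi_tilde_iff product_pairing_def)

section \<open>Normals\<close>

lemma regular_normal_cone_product:
  fixes S1 :: "real^'n \<Rightarrow> real^'l^'m"
  assumes S1: "S1 differentiable (at x)" and y: "y \<in> Xi_tilde S1 S2 (x, z)"
    and n: "(a, b) \<in> regular_normal_cone (gph (product_map S1 S2)) (x, z)"
  shows "(a + transpose (nabla y S1 x) *v b, S1 x *v b) \<in> regular_normal_cone (gph S2) (x, y)"
proof (rule regular_normal_cone_pullback[OF has_derivative_product_pairing[OF S1, of y]])
  show "(x, y) \<in> gph S2" using y by (simp add: mem_Xi_tilde_iff)
  show "(a, b) \<in> regular_normal_cone (product_pairing S1 ` gph S2) (product_pairing S1 (x, y))"
    using n y by (simp add: gph_product_map mem_Xi_tilde_iff product_pairing_def)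
  fix h :: "(real^'n) \<times> (real^'m)"
  have "(transpose (nabla y S1 x) *v b) \<bullet> fst h = b \<bullet> (nabla y S1 x *v fst h)"
    by (simp add: transpose_matrix_vector dot_lmul_matrix)
  moreover have "(S1 x *v b) \<bullet> snd h = b \<bullet> (transpose (S1 x) *v snd h)"
    by (metis dot_lmul_matrix inner_commute transpose_matrix_vector)
  ultimately show "(a + transpose (nabla y S1 x) *v b, S1 x *v b) \<bullet> h =
      (a, b) \<bullet> (case h of (h, v) \<Rightarrow> (h, nabla y S1 x *v h + transpose (S1 x) *v v))"
    by (simp add: case_prod_unfold inner_prod_def inner_add_left inner_add_right)
qed

text \<open>Only the continuity of the derivative of \<open>S1\<close> applied to fixed directions is available, so the
  limit is taken coordinatewise, with the standard basis vectors as directions.\<close>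

lemma transposed_nabla_tendsto:
  assumes S1: "\<forall>x. S1 differentiable (at x)" and C1: "derivative_continuous_at S1 x"
    and x: "xs \<longlonglongrightarrow> x" and y: "ys \<longlonglongrightarrow> y" and b: "bs \<longlonglongrightarrow> b"
  shows "(\<lambda>k. transpose (nabla (ys k) S1 (xs k)) *v bs k) \<longlonglongrightarrow> transpose (nabla y S1 x) *v b"
proof (rule vec_tendstoI)
  fix i
  have comp: "(transpose (nabla y' S1 x') *v b') $ i =
      b' \<bullet> (transpose (frechet_derivative S1 (at x') (axis i 1)) *v y')" for y' x' b'
  proof -
    have "(transpose (nabla y' S1 x') *v b') $ i = (transpose (nabla y' S1 x') *v b') \<bullet> axis i 1"
      by (simp add: inner_axis)
    also have "\<dots> = b' \<bullet> (nabla y' S1 x' *v axis i 1)"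
      by (simp add: transpose_matrix_vector dot_lmul_matrix)
    finally show ?thesis using S1 by (simp add: nabla_eq_frechet_derivative)
  qed
  have "(\<lambda>k. frechet_derivative S1 (at (xs k)) (axis i 1)) \<longlonglongrightarrow> frechet_derivative S1 (at x) (axis i 1)"
    using C1 unfolding derivative_continuous_at_def by (intro isCont_tendsto_compose[OF _ x]) simp
  then show "(\<lambda>k. (transpose (nabla (ys k) S1 (xs k)) *v bs k) $ i) \<longlonglongrightarrow>
      (transpose (nabla y S1 x) *v b) $ i"
    unfolding comp
    by (intro tendsto_inner b bounded_bilinear.tendsto[OF bounded_bilinear_transpose_matrix_vector_mult] y)
qed

lemma pulled_back_normals_tendsto:
  assumes S1: "\<forall>x. S1 differentiable (at x)" and C1: "derivative_continuous_at S1 x"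
    and x: "xs \<longlonglongrightarrow> x" and y: "ys \<longlonglongrightarrow> y" and n: "ns \<longlonglongrightarrow> (a, - b)"
  shows "(\<lambda>k. (fst (ns k) + transpose (nabla (ys k) S1 (xs k)) *v snd (ns k), S1 (xs k) *v snd (ns k)))
    \<longlonglongrightarrow> (a - transpose (nabla y S1 x) *v b, - (S1 x *v b))"
proof -
  have a: "(\<lambda>k. fst (ns k)) \<longlonglongrightarrow> a" and b: "(\<lambda>k. snd (ns k)) \<longlonglongrightarrow> - b"
    using tendsto_fst[OF n] tendsto_snd[OF n] by simp_all
  have "isCont S1 x" using S1 by (simp add: differentiable_imp_continuous_within)
  then have "(\<lambda>k. S1 (xs k)) \<longlonglongrightarrow> S1 x" using x by (rule isCont_tendsto_compose)
  then have "(\<lambda>k. transpose (S1 (xs k))) \<longlonglongrightarrow> transpose (S1 x)"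
    unfolding transpose_def by (intro tendsto_intros)
  from bounded_bilinear.tendsto[OF bounded_bilinear_transpose_matrix_vector_mult this b]
  have "(\<lambda>k. S1 (xs k) *v snd (ns k)) \<longlonglongrightarrow> S1 x *v (- b)" by simp
  from tendsto_Pair[OF tendsto_add[OF a transposed_nabla_tendsto[OF S1 C1 x y b]] this]
  show ?thesis
    by (simp add: linear_neg[OF matrix_vector_mul_linear])
qed

lemma regular_normal_product_selection:
  assumes S1: "\<forall>x. S1 differentiable (at x)"
    and y: "y \<in> Xi_tilde S1 S2 p"
    and n: "n \<in> regular_normal_cone (gph (product_map S1 S2)) p"
  shows "(fst n + transpose (nabla y S1 (fst p)) *v snd n, S1 (fst p) *v snd n)
    \<in> regular_normal_cone (gph S2) (fst p, y)"
  using regular_normal_cone_product[of S1 "fst p" y S2 "snd p" "fst n" "snd n"] S1 y n by simp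

text \<open>The points of the normal sequence lie in the domain of \<open>Xi_tilde\<close>, as regular normals exist only
  at points of the graph; inner semicompactness then provides the points at which to pull back.\<close>

lemma coderivative_product_subset:
  assumes S2: "closed (gph S2)" and S1: "\<forall>x. S1 differentiable (at x)"
    and C1: "derivative_continuous_at S1 xbar"
    and sc: "inner_semicompact (Xi_tilde S1 S2) (xbar, zbar) (dom_map (Xi_tilde S1 S2))"
    and us: "us \<in> coderivative (product_map S1 S2) (xbar, zbar) zs"
  obtains ybar where "ybar \<in> Xi_tilde S1 S2 (xbar, zbar)"
    "us - transpose (nabla ybar S1 xbar) *v zs \<in> coderivative S2 (xbar, ybar) (S1 xbar *v zs)"
proof -
  obtain ps ns where ps: "ps \<longlonglongrightarrow> (xbar, zbar)" and ns: "ns \<longlonglongrightarrow> (us, - zs)"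
    and n: "\<And>k. ns k \<in> regular_normal_cone (gph (product_map S1 S2)) (ps k)"
    using us unfolding coderivative_def limiting_normal_cone_def by blast
  have "ps k \<in> dom_map (Xi_tilde S1 S2)" for k
    using n[of k] by (auto simp: regular_normal_cone_def gph_product_map_eq_dom split: if_splits)
  then obtain r ys y where r: "strict_mono (r :: nat \<Rightarrow> nat)"
    and ys: "\<And>k. ys k \<in> Xi_tilde S1 S2 (ps (r k))" and y: "ys \<longlonglongrightarrow> y"
    using sc ps unfolding inner_semicompact_def by blast
  have pr: "(\<lambda>k. ps (r k)) \<longlonglongrightarrow> (xbar, zbar)" and nr: "(\<lambda>k. ns (r k)) \<longlonglongrightarrow> (us, - zs)"
    using LIMSEQ_subseq_LIMSEQ[OF ps r] LIMSEQ_subseq_LIMSEQ[OF ns r] by (simp_all add: o_def)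
  have "((xbar, zbar), y) \<in> gph (Xi_tilde S1 S2)"
    using closed_sequentially[OF closed_gph_Xi_tilde[OF S2 S1] _ tendsto_Pair[OF pr y]] ys
    by (simp add: gph_def)
  then have ybar: "y \<in> Xi_tilde S1 S2 (xbar, zbar)" by (simp add: gph_def)
  have x: "(\<lambda>k. fst (ps (r k))) \<longlonglongrightarrow> xbar" using tendsto_fst[OF pr] by simp
  have "us - transpose (nabla y S1 xbar) *v zs \<in> coderivative S2 (xbar, y) (S1 xbar *v zs)"
    unfolding coderivative_def limiting_normal_cone_def
    using ybar pulled_back_normals_tendsto[OF S1 C1 x y nr] tendsto_Pair[OF x y]
      regular_normal_product_selection[OF S1 ys n]
    by (auto simp: mem_Xi_tilde_iff)
  with ybar that show ?thesis by blast
qed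

text \<open>The directional version pulls back along a calm selection, whose difference quotients supply the
  missing component \<open>v\<close> of the direction in the graph of \<open>S2\<close>.\<close>

lemma directional_coderivative_product_subset:
  assumes S2: "closed (gph S2)" and S1: "\<forall>x. S1 differentiable (at x)"
    and C1: "derivative_continuous_at S1 xbar"
    and calm: "inner_calm_star_dir (Xi_tilde S1 S2) (xbar, zbar) d (dom_map (Xi_tilde S1 S2))"
    and us: "us \<in> directional_coderivative (product_map S1 S2) (xbar, zbar) d zs"
  obtains ybar v where "ybar \<in> Xi_tilde S1 S2 (xbar, zbar)"
    "v \<in> graphical_derivative (Xi_tilde S1 S2) ((xbar, zbar), ybar) d"
    "us - transpose (nabla ybar S1 xbar) *v zs \<in>
      directional_coderivative S2 (xbar, ybar) (fst d, v) (S1 xbar *v zs)"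
proof -
  let ?p = "(xbar, zbar)"
  obtain t ds ns where t: "\<forall>k. (0::real) < t k" "t \<longlonglongrightarrow> 0" and ds: "ds \<longlonglongrightarrow> d"
    and ns: "ns \<longlonglongrightarrow> (us, - zs)"
    and n: "\<And>k. ns k \<in> regular_normal_cone (gph (product_map S1 S2)) (?p + t k *\<^sub>R ds k)"
    using us unfolding directional_coderivative_def directional_normal_cone_def by blast
  define ps where "ps k = ?p + t k *\<^sub>R ds k" for k
  have "ps k \<in> dom_map (Xi_tilde S1 S2)" for k
    using n[of k] by (auto simp: ps_def regular_normal_cone_def gph_product_map_eq_dom split: if_splits)
  then have "\<forall>k. ps k \<in> dom_map (Xi_tilde S1 S2)" ..
  moreover have "converges_from_direction ps ?p d"
    unfolding converges_from_direction_def by (intro exI[of _ t] exI[of _ ds] conjI t ds) (simp add: ps_def)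
  moreover obtain \<kappa> where \<kappa>: "\<kappa> > 0"
    and sel: "\<forall>y_seq. (\<forall>k. y_seq k \<in> dom_map (Xi_tilde S1 S2)) \<and>
        converges_from_direction y_seq ?p d \<longrightarrow>
      (\<exists>K y q. infinite K \<and>
        (\<forall>k\<in>K. y k \<in> Xi_tilde S1 S2 (y_seq k) \<and> norm (y k - q) \<le> \<kappa> * norm (y_seq k - ?p)))"
    using calm unfolding inner_calm_star_dir_def by (elim exE conjE) (rule that)
  ultimately have "\<exists>K y q. infinite K \<and>
      (\<forall>k\<in>K. y k \<in> Xi_tilde S1 S2 (ps k) \<and> norm (y k - q) \<le> \<kappa> * norm (ps k - ?p))"
    by simp
  then obtain K y q where K: "infinite K"
    and y: "\<forall>k\<in>K. y k \<in> Xi_tilde S1 S2 (ps k) \<and> norm (y k - q) \<le> \<kappa> * norm (ps k - ?p)"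
    by (elim exE conjE) (rule that)
  obtain s :: "nat \<Rightarrow> nat" where s: "strict_mono s" and sK: "\<And>k. s k \<in> K"
    using infinite_enumerate[OF K] by blast
  have ts: "\<forall>k. 0 < t (s k)" "(\<lambda>k. t (s k)) \<longlonglongrightarrow> 0" and dss: "(\<lambda>k. ds (s k)) \<longlonglongrightarrow> d"
    using t LIMSEQ_subseq_LIMSEQ[OF t(2) s] LIMSEQ_subseq_LIMSEQ[OF ds s] by (simp_all add: o_def)
  have ysel: "\<And>k. y (s k) \<in> Xi_tilde S1 S2 (?p + t (s k) *\<^sub>R ds (s k))"
    "\<And>k. norm (y (s k) - q) \<le> \<kappa> * norm (t (s k) *\<^sub>R ds (s k))"
    using y sK by (auto simp: ps_def)
  note calm_selection = calm_selection_subsequence[where R = "Xi_tilde S1 S2" and p = ?p and q = q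
      and d = d and t = "\<lambda>k. t (s k)" and ds = "\<lambda>k. ds (s k)" and y = "\<lambda>k. y (s k)",
      OF closed_gph_Xi_tilde[OF S2 S1] ts dss ysel \<kappa>]
  have q: "q \<in> Xi_tilde S1 S2 ?p" by (rule calm_selection(1))
  obtain r vs v where r: "strict_mono (r :: nat \<Rightarrow> nat)" and vs: "vs \<longlonglongrightarrow> v"
    and yr: "\<forall>k. y (s (r k)) = q + t (s (r k)) *\<^sub>R vs k"
    and v: "v \<in> graphical_derivative (Xi_tilde S1 S2) (?p, q) d"
    using calm_selection(2) by (elim exE conjE) (rule that)
  \<comment> \<open>The selection lives on \<open>K\<close>, its quotients converge along a further subsequence;
    \<open>m\<close> indexes both extractions.\<close>
  define m where "m k = s (r k)" for k
  have m: "strict_mono m" using strict_mono_o[OF s r] by (simp add: m_def[abs_def] o_def)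
  have tm: "\<forall>k. 0 < t (m k)" "(\<lambda>k. t (m k)) \<longlonglongrightarrow> 0" and dm: "(\<lambda>k. ds (m k)) \<longlonglongrightarrow> d"
    and nm: "(\<lambda>k. ns (m k)) \<longlonglongrightarrow> (us, - zs)"
    using t LIMSEQ_subseq_LIMSEQ[OF t(2) m] LIMSEQ_subseq_LIMSEQ[OF ds m]
      LIMSEQ_subseq_LIMSEQ[OF ns m] by (simp_all add: o_def)
  define xs where "xs k = fst (?p + t (m k) *\<^sub>R ds (m k))" for k
  define ys where "ys k = q + t (m k) *\<^sub>R vs k" for k
  have "(\<lambda>k. ?p + t (m k) *\<^sub>R ds (m k)) \<longlonglongrightarrow> ?p + 0 *\<^sub>R d"
    by (intro tendsto_intros tm dm)
  from tendsto_fst[OF this] have x: "xs \<longlonglongrightarrow> xbar" by (simp add: xs_def[abs_def])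
  have "(\<lambda>k. q + t (m k) *\<^sub>R vs k) \<longlonglongrightarrow> q + 0 *\<^sub>R v"
    by (intro tendsto_intros tm vs)
  then have yq: "ys \<longlonglongrightarrow> q" by (simp add: ys_def[abs_def])
  have ysel': "ys k \<in> Xi_tilde S1 S2 (?p + t (m k) *\<^sub>R ds (m k))" for k
    using ysel(1)[of "r k"] yr by (simp add: ys_def m_def)
  have base: "(xs k, ys k) = (xbar, q) + t (m k) *\<^sub>R (fst (ds (m k)), vs k)" for k
    by (simp add: xs_def ys_def)
  have dirs: "(\<lambda>k. (fst (ds (m k)), vs k)) \<longlonglongrightarrow> (fst d, v)"
    by (intro tendsto_Pair tendsto_fst dm vs)
  have norms: "(fst (ns (m k)) + transpose (nabla (ys k) S1 (xs k)) *v snd (ns (m k)),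
      S1 (xs k) *v snd (ns (m k)))
      \<in> regular_normal_cone (gph S2) ((xbar, q) + t (m k) *\<^sub>R (fst (ds (m k)), vs k))" for k
    using regular_normal_product_selection[OF S1 ysel' n] unfolding base[symmetric]
    by (simp add: xs_def)
  have "us - transpose (nabla q S1 xbar) *v zs \<in>
      directional_coderivative S2 (xbar, q) (fst d, v) (S1 xbar *v zs)"
    unfolding directional_coderivative_def directional_normal_cone_def mem_Collect_eq
    by (intro conjI exI, use q in \<open>simp add: mem_Xi_tilde_iff\<close>)
      (rule tm dirs pulled_back_normals_tendsto[OF S1 C1 x yq nm] allI norms)+
  with q v that show ?thesis by blast
qed

section \<open>The calculus rules for the product\<close>

theorem theorem4p10:
  fixes S1 :: "real^'n \<Rightarrow> real^'l^'m"
    and S2 :: "real^'n \<Rightarrow> (real^'m) set"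
    and xbar u :: "real^'n"
    and zbar w :: "real^'l"
  assumes "closed (gph S2)"
    and "\<forall>x. S1 differentiable (at x)"
    and "(xbar, zbar) \<in> gph (product_map S1 S2)"
    and "inner_semicompact (Xi_tilde S1 S2) (xbar, zbar) (dom_map (Xi_tilde S1 S2))"
  shows
    "(inner_calm_star_fuzzy (Xi_tilde S1 S2) (xbar, zbar) (dom_map (Xi_tilde S1 S2)) \<longrightarrow>
        graphical_derivative (product_map S1 S2) (xbar, zbar) u =
          (\<Union>ybar \<in> Xi_tilde S1 S2 (xbar, zbar).
            (\<lambda>v. nabla ybar S1 xbar *v u + transpose (S1 xbar) *v v) `
              graphical_derivative S2 (xbar, ybar) u))
     \<and>
     (derivative_continuous_at S1 xbar \<longrightarrow>
      inner_calm_star_dir (Xi_tilde S1 S2) (xbar, zbar) (u, w) (dom_map (Xi_tilde S1 S2)) \<longrightarrow>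
        (\<forall>zs. directional_coderivative (product_map S1 S2) (xbar, zbar) (u, w) zs \<subseteq>
          (\<Union>ybar \<in> Xi_tilde S1 S2 (xbar, zbar).
            \<Union>v \<in> graphical_derivative (Xi_tilde S1 S2) ((xbar, zbar), ybar) (u, w).
              (\<lambda>us. transpose (nabla ybar S1 xbar) *v zs + us) `
                directional_coderivative S2 (xbar, ybar) (u, v) (S1 xbar *v zs))))
     \<and>
     (derivative_continuous_at S1 xbar \<longrightarrow>
        (\<forall>zs. coderivative (product_map S1 S2) (xbar, zbar) zs \<subseteq>
          (\<Union>ybar \<in> Xi_tilde S1 S2 (xbar, zbar).
            (\<lambda>us. transpose (nabla ybar S1 xbar) *v zs + us) `
              coderivative S2 (xbar, ybar) (S1 xbar *v zs))))"
proof (intro conjI impI allI)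
  let ?Xi = "Xi_tilde S1 S2"
  have S1: "S1 differentiable (at xbar)" using assms(2) by simp
  have Xi: "closed (gph ?Xi)" using closed_gph_Xi_tilde assms(1,2) .
  {
    assume fuzzy: "inner_calm_star_fuzzy ?Xi (xbar, zbar) (dom_map ?Xi)"
    show "graphical_derivative (product_map S1 S2) (xbar, zbar) u =
      (\<Union>ybar \<in> ?Xi (xbar, zbar). (\<lambda>v. nabla ybar S1 xbar *v u + transpose (S1 xbar) *v v) `
        graphical_derivative S2 (xbar, ybar) u)"
    proof (intro equalityI subsetI)
      fix z assume "z \<in> graphical_derivative (product_map S1 S2) (xbar, zbar) u"
      then have "(u, z) \<in> tangent_cone (dom_map ?Xi) (xbar, zbar)"
        by (simp add: graphical_derivative_def gph_product_map_eq_dom)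
      then obtain ybar v where y: "ybar \<in> ?Xi (xbar, zbar)"
        and v: "v \<in> graphical_derivative ?Xi ((xbar, zbar), ybar) (u, z)"
        by (rule fuzzy_calm_lifts_tangents[OF Xi fuzzy])
      show "z \<in> (\<Union>ybar \<in> ?Xi (xbar, zbar).
          (\<lambda>v. nabla ybar S1 xbar *v u + transpose (S1 xbar) *v v) `
            graphical_derivative S2 (xbar, ybar) u)"
        by (rule UN_I[OF y image_eqI]) (rule graphical_derivative_Xi_tilde[OF S1 v])+
    qed (elim UN_E imageE, simp only: graphical_derivative_product_supset[OF S1])
  next
    fix zs
    assume C1: "derivative_continuous_at S1 xbar"
      and calm: "inner_calm_star_dir ?Xi (xbar, zbar) (u, w) (dom_map ?Xi)"
    show "directional_coderivative (product_map S1 S2) (xbar, zbar) (u, w) zs \<subseteq>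
      (\<Union>ybar \<in> ?Xi (xbar, zbar).
        \<Union>v \<in> graphical_derivative ?Xi ((xbar, zbar), ybar) (u, w).
          (\<lambda>us. transpose (nabla ybar S1 xbar) *v zs + us) `
            directional_coderivative S2 (xbar, ybar) (u, v) (S1 xbar *v zs))"
    proof
      fix us assume "us \<in> directional_coderivative (product_map S1 S2) (xbar, zbar) (u, w) zs"
      then obtain ybar v where yv: "ybar \<in> ?Xi (xbar, zbar)"
        "v \<in> graphical_derivative ?Xi ((xbar, zbar), ybar) (u, w)"
        and "us - transpose (nabla ybar S1 xbar) *v zs \<in>
          directional_coderivative S2 (xbar, ybar) (fst (u, w), v) (S1 xbar *v zs)"
        by (rule directional_coderivative_product_subset[OF assms(1,2) C1 calm])
      then have "us \<in> (\<lambda>us. transpose (nabla ybar S1 xbar) *v zs + us) `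
          directional_coderivative S2 (xbar, ybar) (u, v) (S1 xbar *v zs)"
        by (intro image_eqI[of _ _ "us - transpose (nabla ybar S1 xbar) *v zs"]) simp_all
      with yv show "us \<in> (\<Union>ybar \<in> ?Xi (xbar, zbar).
        \<Union>v \<in> graphical_derivative ?Xi ((xbar, zbar), ybar) (u, w).
          (\<lambda>us. transpose (nabla ybar S1 xbar) *v zs + us) `
            directional_coderivative S2 (xbar, ybar) (u, v) (S1 xbar *v zs))"
        by (intro UN_I[of ybar] UN_I[of v])
    qed
  next
    fix zs
    assume C1: "derivative_continuous_at S1 xbar"
    show "coderivative (product_map S1 S2) (xbar, zbar) zs \<subseteq>
      (\<Union>ybar \<in> ?Xi (xbar, zbar). (\<lambda>us. transpose (nabla ybar S1 xbar) *v zs + us) `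
        coderivative S2 (xbar, ybar) (S1 xbar *v zs))"
    proof
      fix us assume "us \<in> coderivative (product_map S1 S2) (xbar, zbar) zs"
      then obtain ybar where y: "ybar \<in> ?Xi (xbar, zbar)"
        and "us - transpose (nabla ybar S1 xbar) *v zs \<in> coderivative S2 (xbar, ybar) (S1 xbar *v zs)"
        by (rule coderivative_product_subset[OF assms(1,2) C1 assms(4)])
      then have "us \<in> (\<lambda>us. transpose (nabla ybar S1 xbar) *v zs + us) `
          coderivative S2 (xbar, ybar) (S1 xbar *v zs)"
        by (intro image_eqI[of _ _ "us - transpose (nabla ybar S1 xbar) *v zs"]) simp_all
      with y show "us \<in> (\<Union>ybar \<in> ?Xi (xbar, zbar).
          (\<lambda>us. transpose (nabla ybar S1 xbar) *v zs + us) `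
            coderivative S2 (xbar, ybar) (S1 xbar *v zs))"
        by (rule UN_I)
    qed
  }
qed

end
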